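(* Let $q$ be a prime power and let $k$ be a positive integer. If $S$ is a multiset of integers of size $(q^k-1)/(q-1)$ and $\delta_q(S)>-q^{k-1}$, then $S$ is $q$-projection-forcing.
   Context: Let $\mathbb{F}_q$ be the finite field with $q$ elements. A linear code is a linear subspace of some $\mathbb{F}_q^n$. The Hamming weight $w(v)$ of a vector $v$ is its number of nonzero entries. For a linear code $U$, $P(U)$ is the set of equivalence classes of $U\setminus\{0\}$ under $v_1\sim v_2$ iff $v_1=\alpha v_2$ for some nonzero scalar $\alpha\in\mathbb{F}_q$. Given linear codes $U\subseteq\mathbb{F}_q^n$, $V\subseteq\mathbb{F}_q^m$ and a linear map $\phi:U\to V$, the projective multiset of weight changes of $\phi$ is the multiset $\{w(u)-w(\phi(u)) : u\in P(U)\}$, where $w(u)-w(\phi(u))$ is computed on any representative (it does not depend on the choice). If $S$ is the projective multiset of weight changes of $\phi$, then $\phi$ realizes $S$. A linear map $\phi:U\to V$ between linear codes $U\subseteq\mathbb{F}_q^n$, $V\subseteq\mathbb{F}_q^m$ is called a projection if it is given by multiplication by a matrix over $\mathbb{F}_q$ with at most one nonzero entry in each row and each column. A multiset $S$ of integers is $q$-projection-forcing if every $\mathbb{F}_q$-linear map between linear codes (with any $n,m$) that realizes $S$ is a projection. For a multiset $S=\{s_1,\dots,s_{(q^k-1)/(q-1)}\}$ of integers with $s_i\le s_{i+1}$ for all $i$, the $q$-ary split difference is $$\delta_q(S)=\sum_{i=1}^{q^{k-1}} s_i-(q-1)\sum_{i=q^{k-1}+1}^{(q^k-1)/(q-1)}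 s_i .$$ *)

theory Defs
  imports "Jordan_Normal_Form.VS_Connect" "HOL-Library.Multiset" "HOL-Library.Cardinality"
begin

text \<open>
  The field with \<open>q\<close> elements is a type \<open>'a :: {field, finite}\<close> with \<open>CARD('a) = q\<close>.
  Words of length \<open>n\<close> over it are the elements of \<open>carrier_vec n\<close>.
\<close>

definition hamming_weight :: "'a :: zero vec \<Rightarrow> nat" where
  "hamming_weight v = card {i. i < dim_vec v \<and> v $ i \<noteq> 0}"

definition linear_code :: "nat \<Rightarrow> 'a :: field vec set \<Rightarrow> bool" where
  "linear_code n U \<longleftrightarrow> VectorSpace.subspace class_ring U (module_vec TYPE('a) n)"

definition code_map ::
  "nat \<Rightarrow> 'a :: field vec set \<Rightarrow> nat \<Rightarrow> 'a vec set \<Rightarrow> ('a vec \<Rightarrow> 'a vec) \<Rightarrow> bool" where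
  "code_map n U m V \<phi> \<longleftrightarrow>
     linear_code n U \<and> linear_code m V \<and>
     linear_map class_ring
       (module_vec TYPE('a) n\<lparr>carrier := U\<rparr>) (module_vec TYPE('a) m\<lparr>carrier := V\<rparr>) \<phi>"

definition proj_rel :: "nat \<Rightarrow> 'a :: field vec set \<Rightarrow> ('a vec \<times> 'a vec) set" where
  "proj_rel n U =
     {(v1, v2). v1 \<in> U - {0\<^sub>v n} \<and> v2 \<in> U - {0\<^sub>v n} \<and> (\<exists>\<alpha>. \<alpha> \<noteq> 0 \<and> v1 = \<alpha> \<cdot>\<^sub>v v2)}"

definition proj_points :: "nat \<Rightarrow> 'a :: field vec set \<Rightarrow> 'a vec set set" where
  "proj_points n U = (U - {0\<^sub>v n}) // proj_rel n U"

definition weight_change :: "('a :: field vec \<Rightarrow> 'a vec) \<Rightarrow> 'a vec \<Rightarrow> int" where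
  "weight_change \<phi> u = int (hamming_weight u) - int (hamming_weight (\<phi> u))"

text \<open>
  For linear \<open>\<phi>\<close> the weight change is constant on every class, so the image of a class is a
  singleton and \<open>the_elem\<close> picks the common value; see \<open>weight_change_class\<close> below.
\<close>

definition weight_changes ::
  "nat \<Rightarrow> 'a :: field vec set \<Rightarrow> ('a vec \<Rightarrow> 'a vec) \<Rightarrow> int multiset" where
  "weight_changes n U \<phi> =
     image_mset (\<lambda>C. the_elem (weight_change \<phi> ` C)) (mset_set (proj_points n U))"

definition realizes ::
  "nat \<Rightarrow> 'a :: field vec set \<Rightarrow> ('a vec \<Rightarrow> 'a vec) \<Rightarrow> int multiset \<Rightarrow> bool" where
  "realizes n U \<phi> S \<longleftrightarrow> weight_changes n U \<phi> = S"

definition is_projection ::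
  "nat \<Rightarrow> 'a :: field vec set \<Rightarrow> nat \<Rightarrow> ('a vec \<Rightarrow> 'a vec) \<Rightarrow> bool" where
  "is_projection n U m \<phi> \<longleftrightarrow>
     (\<exists>A \<in> carrier_mat m n.
        (\<forall>i<m. card {j. j < n \<and> A $$ (i, j) \<noteq> 0} \<le> 1) \<and>
        (\<forall>j<n. card {i. i < m \<and> A $$ (i, j) \<noteq> 0} \<le> 1) \<and>
        (\<forall>u\<in>U. \<phi> u = A *\<^sub>v u))"

definition projection_forcing :: "'a :: {field, finite} itself \<Rightarrow> int multiset \<Rightarrow> bool" where
  "projection_forcing F S \<longleftrightarrow>
     (\<forall>n m (U :: 'a vec set) (V :: 'a vec set) \<phi>.
        code_map n U m V \<phi> \<longrightarrow> realizes n U \<phi> S \<longrightarrow> is_projection n U m \<phi>)"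

text \<open>
  The list is 0-indexed, so the term \<open>s\<^sub>i\<close> of the usual definition is entry \<open>i - 1\<close>.
  Only meaningful when \<open>size S = (q ^ k - 1) div (q - 1)\<close>, where the division is exact.
\<close>

definition split_difference :: "nat \<Rightarrow> nat \<Rightarrow> int multiset \<Rightarrow> int" where
  "split_difference q k S =
     (let s = sorted_list_of_multiset S in
        (\<Sum>i = 0..<q ^ (k - 1). s ! i)
        - (int q - 1) * (\<Sum>i = q ^ (k - 1)..<(q ^ k - 1) div (q - 1). s ! i))"

lemma hamming_weight_smult:
  fixes v :: "'a :: field vec"
  assumes "\<alpha> \<noteq> 0"
  shows "hamming_weight (\<alpha> \<cdot>\<^sub>v v) = hamming_weight v"
proof -
  have "{i. i < dim_vec v \<and> (\<alpha> \<cdot>\<^sub>v v) $ i \<noteq> 0} = {i. i < dim_vec v \<and> v $ i \<noteq> 0}"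
    using assms by auto
  then show ?thesis by (simp add: hamming_weight_def)
qed

lemma weight_change_class:
  fixes \<phi> :: "'a :: field vec \<Rightarrow> 'a vec"
  assumes \<phi>: "code_map n U m V \<phi>" and C: "C \<in> proj_points n U" and u: "u \<in> C"
  shows "the_elem (weight_change \<phi> ` C) = weight_change \<phi> u"
proof -
  have sub: "U \<subseteq> carrier_vec n"
    and hom: "\<phi> \<in> LinearCombinations.module_hom class_ring
        (module_vec TYPE('a) n\<lparr>carrier := U\<rparr>) (module_vec TYPE('a) m\<lparr>carrier := V\<rparr>)"
    using \<phi> by (auto simp: code_map_def linear_code_def VectorSpace.subspace_def submodule_def
        module_vec_simps linear_map_def mod_hom_def mod_hom_axioms_def)
  have smult: "\<phi> (a \<cdot>\<^sub>v v) = a \<cdot>\<^sub>v \<phi> v" if "v \<in> U" for a v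
    using hom that by (auto simp: LinearCombinations.module_hom_def module_vec_def)
  from C obtain x where x: "x \<in> U" and Cx: "C = proj_rel n U `` {x}"
    by (auto simp: proj_points_def quotient_def)
  have "weight_change \<phi> v = weight_change \<phi> x" if "v \<in> C" for v
  proof -
    from that Cx obtain a where v: "v \<in> U" and a: "a \<noteq> 0" "x = a \<cdot>\<^sub>v v"
      by (auto simp: proj_rel_def)
    then show ?thesis
      by (simp add: weight_change_def smult hamming_weight_smult)
  qed
  then have "weight_change \<phi> ` C = {weight_change \<phi> u}"
    using u by auto
  then show ?thesis by simp
qed

lemma finite_proj_points:
  fixes U :: "'a :: {field, finite} vec set"
  assumes "linear_code n U"
  shows "finite (proj_points n U)"
proof -
  have "U \<subseteq> carrier_vec n"
    using assms by (auto simp: linear_code_def VectorSpace.subspace_def submodule_def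
        module_vec_simps)
  also have "carrier_vec n \<subseteq> vec_of_list ` {xs :: 'a list. set xs \<subseteq> UNIV \<and> length xs = n}"
  proof
    fix v :: "'a vec" assume "v \<in> carrier_vec n"
    then show "v \<in> vec_of_list ` {xs :: 'a list. set xs \<subseteq> UNIV \<and> length xs = n}"
      by (intro image_eqI[of _ _ "list_of_vec v"]) (auto simp: vec_list)
  qed
  finally have "finite U"
    using finite_lists_length_eq[of "UNIV :: 'a set" n] by (meson finite_imageI finite_subset finite)
  then show ?thesis
    unfolding proj_points_def
    by (intro finite_quotient) (auto simp: proj_rel_def)
qed

end

theory Submission
  imports Defs
begin

text \<open>
  Read the coordinates of \<open>u\<close> and of \<open>\<phi> u\<close> as linear functionals on \<open>U\<close>. For a hyperplane
  \<open>H\<close> of \<open>U\<close> let \<open>f H\<close> be the number of input coordinates with kernel \<open>H\<close> minus the number of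
  output coordinates with kernel \<open>H\<close>. A nonzero functional whose kernel is not \<open>H\<close> is nonzero
  at the same proportion of the vectors of \<open>H\<close> and of \<open>U\<close>. So, with \<open>u\<close> ranging over \<open>P(U)\<close>, the weight
  changes \<open>c u\<close> satisfy
  \<open>q ^ (k - 1) * f H = (\<Sum>u \<notin> H. c u) - (q - 1) * (\<Sum>u \<in> H. c u)\<close>. There are
  \<open>q ^ (k - 1)\<close> points outside \<open>H\<close>, hence the right-hand side is at least \<open>\<delta>\<^sub>q(S) > - q ^ (k - 1)\<close>
  and the integer \<open>f H\<close> is nonnegative. So the nonzero output coordinates can be matched
  injectively with input coordinates having the same kernel, which are scalar multiples of them.
\<close>

section \<open>Linear codes, functionals on them and kernels\<close>

lemma linear_code_iff:
  fixes U :: "'a :: field vec set"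
  shows "linear_code n U \<longleftrightarrow> U \<subseteq> carrier_vec n \<and> 0\<^sub>v n \<in> U \<and>
    (\<forall>u\<in>U. \<forall>v\<in>U. u + v \<in> U) \<and> (\<forall>a. \<forall>u\<in>U. a \<cdot>\<^sub>v u \<in> U)"
proof -
  have "vectorspace class_ring (module_vec TYPE('a) n)"
    by (rule vec_vs)
  moreover have "module class_ring (module_vec TYPE('a) n)"
    by (rule vec_module)
  ultimately show ?thesis
    unfolding linear_code_def VectorSpace.subspace_def submodule_def
    by (auto simp: module_vec_simps class_ring_simps)
qed

lemma zero_smult_carrier_vec:
  fixes v :: "'a :: semiring_0 vec"
  shows "v \<in> carrier_vec n \<Longrightarrow> 0 \<cdot>\<^sub>v v = 0\<^sub>v n"
  by (intro eq_vecI) auto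

text \<open>Linearity is asked for on \<open>U\<close> only: a code map, and hence each coordinate
  of its output, is unconstrained outside its code.\<close>

definition linear_functional_on :: "'a :: field vec set \<Rightarrow> ('a vec \<Rightarrow> 'a) \<Rightarrow> bool" where
  "linear_functional_on U \<mu> \<longleftrightarrow>
     (\<forall>u\<in>U. \<forall>v\<in>U. \<mu> (u + v) = \<mu> u + \<mu> v) \<and> (\<forall>a. \<forall>u\<in>U. \<mu> (a \<cdot>\<^sub>v u) = a * \<mu> u)"

definition kernel_on :: "'a :: field vec set \<Rightarrow> ('a vec \<Rightarrow> 'a) \<Rightarrow> 'a vec set" where
  "kernel_on U \<mu> = {u \<in> U. \<mu> u = 0}"

lemma linear_functional_on_subset:
  "linear_functional_on U \<mu> \<Longrightarrow> W \<subseteq> U \<Longrightarrow> linear_functional_on W \<mu>"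
  unfolding linear_functional_on_def by blast

text \<open>Lets the counting results for codes be applied again to the restriction of a second
  functional to a kernel.\<close>

lemma linear_code_kernel_on:
  fixes U :: "'a :: field vec set"
  assumes U: "linear_code n U" and \<mu>: "linear_functional_on U \<mu>"
  shows "linear_code n (kernel_on U \<mu>)"
proof -
  have "0\<^sub>v n \<in> U" using U by (simp add: linear_code_iff)
  then have "\<mu> (0 \<cdot>\<^sub>v 0\<^sub>v n) = 0 * \<mu> (0\<^sub>v n)"
    using \<mu> unfolding linear_functional_on_def by blast
  moreover have "(0 :: 'a) \<cdot>\<^sub>v 0\<^sub>v n = 0\<^sub>v n" by (simp add: zero_smult_carrier_vec)
  ultimately have "\<mu> (0\<^sub>v n) = 0" by simp
  with U \<mu> show ?thesis
    unfolding linear_code_iff linear_functional_on_def kernel_on_def by auto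
qed

lemma linear_code_finite:
  fixes U :: "'a :: {field, finite} vec set"
  assumes "linear_code n U"
  shows "finite U"
proof -
  have "U \<subseteq> vec_of_list ` {xs :: 'a list. set xs \<subseteq> UNIV \<and> length xs = n}"
  proof
    fix v assume "v \<in> U"
    then show "v \<in> vec_of_list ` {xs :: 'a list. set xs \<subseteq> UNIV \<and> length xs = n}"
      using assms
      by (intro image_eqI[of _ _ "list_of_vec v"]) (auto simp: vec_list linear_code_iff)
  qed
  then show ?thesis
    using finite_lists_length_eq[of "UNIV :: 'a set" n] by (meson finite_imageI finite_subset finite)
qed

section \<open>Counting zeros and nonzeros of functionals\<close>

text \<open>A functional that is nonzero on \<open>U\<close> takes the value 1 at some
  \<open>z\<close> in \<open>U\<close>. Each \<open>u\<close> in \<open>U\<close> is then uniquely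
  \<open>v + a z\<close> with \<open>v\<close> in the kernel and \<open>a = \<mu> u\<close>, so
  \<open>U\<close> is in bijection with pairs of a scalar and a kernel vector.\<close>

lemma card_kernel_on:
  fixes U :: "'a :: {field, finite} vec set"
  assumes U: "linear_code n U" and \<mu>: "linear_functional_on U \<mu>" and ne: "kernel_on U \<mu> \<noteq> U"
  shows "card U = CARD('a) * card (kernel_on U \<mu>)"
proof -
  from ne obtain w where w: "w \<in> U" "\<mu> w \<noteq> 0" by (auto simp: kernel_on_def)
  have carr: "U \<subseteq> carrier_vec n" and add: "\<And>u v. u \<in> U \<Longrightarrow> v \<in> U \<Longrightarrow> u + v \<in> U"
    and smult: "\<And>a u. u \<in> U \<Longrightarrow> a \<cdot>\<^sub>v u \<in> U"
    using U by (auto simp: linear_code_iff)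
  have \<mu>add: "\<And>u v. u \<in> U \<Longrightarrow> v \<in> U \<Longrightarrow> \<mu> (u + v) = \<mu> u + \<mu> v"
    and \<mu>smult: "\<And>a u. u \<in> U \<Longrightarrow> \<mu> (a \<cdot>\<^sub>v u) = a * \<mu> u"
    using \<mu> by (auto simp: linear_functional_on_def)
  define z where "z = inverse (\<mu> w) \<cdot>\<^sub>v w"
  have z: "z \<in> U" "\<mu> z = 1" using w by (auto simp: z_def smult \<mu>smult)
  have zc: "z \<in> carrier_vec n" using z carr by auto
  define f where "f = (\<lambda>(a, v). v + a \<cdot>\<^sub>v z)"
  define g where "g u = (\<mu> u, u + (- \<mu> u) \<cdot>\<^sub>v z)" for u
  have "bij_betw f (UNIV \<times> kernel_on U \<mu>) U"
  proof (rule bij_betw_byWitness[where f' = g])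
    show "\<forall>x\<in>UNIV \<times> kernel_on U \<mu>. g (f x) = x"
    proof clarify
      fix a v assume v: "v \<in> kernel_on U \<mu>"
      then have vU: "v \<in> U" "v \<in> carrier_vec n" "\<mu> v = 0" using carr by (auto simp: kernel_on_def)
      have 1: "\<mu> (v + a \<cdot>\<^sub>v z) = a" using vU z by (simp add: \<mu>add \<mu>smult smult)
      have 2: "v + a \<cdot>\<^sub>v z + (- a) \<cdot>\<^sub>v z = v" using vU zc by auto
      show "g (f (a, v)) = (a, v)"
        using 1 2 by (simp add: f_def g_def)
    qed
    show "\<forall>u\<in>U. f (g u) = u"
    proof
      fix u assume "u \<in> U"
      then have "u \<in> carrier_vec n" using carr by auto
      then show "f (g u) = u" using zc by (intro eq_vecI) (auto simp: f_def g_def)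
    qed
    show "f ` (UNIV \<times> kernel_on U \<mu>) \<subseteq> U"
      using z by (auto simp: f_def kernel_on_def add smult)
    show "g ` U \<subseteq> UNIV \<times> kernel_on U \<mu>"
      using z by (auto simp: g_def kernel_on_def add smult \<mu>add \<mu>smult)
  qed
  then have "card (UNIV \<times> kernel_on U \<mu> :: ('a \<times> 'a vec) set) = card U"
    by (rule bij_betw_same_card)
  then show ?thesis by (simp add: card_cartesian_product)
qed

text \<open>If \<open>\<mu>\<close> has the same kernel as \<open>\<nu>\<close>, it vanishes on that
  hyperplane and only the first count survives. If \<open>\<mu>\<close> vanishes on
  \<open>U\<close>, both counts are 0. Otherwise \<open>\<mu>\<close> is nonzero on the hyperplane
  too, so passing from it to \<open>U\<close> multiplies both its size and the number of zeros of
  \<open>\<mu>\<close> by the field size, and the terms cancel.\<close>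

lemma nonvanishing_count_balance:
  fixes U :: "'a :: {field, finite} vec set"
  assumes U: "linear_code n U"
    and \<mu>: "linear_functional_on U \<mu>" and \<nu>: "linear_functional_on U \<nu>"
    and ne: "kernel_on U \<nu> \<noteq> U"
  shows "int (card {u \<in> U. \<mu> u \<noteq> 0}) - int CARD('a) * int (card {u \<in> kernel_on U \<nu>. \<mu> u \<noteq> 0})
    = (if kernel_on U \<mu> = kernel_on U \<nu> then int (card U) - int (card (kernel_on U \<nu>)) else 0)"
proof -
  let ?H = "kernel_on U \<nu>"
  have H: "linear_code n ?H" using U \<nu> by (rule linear_code_kernel_on)
  have HU: "?H \<subseteq> U" by (auto simp: kernel_on_def)
  have \<mu>H: "linear_functional_on ?H \<mu>" using \<mu> HU by (rule linear_functional_on_subset)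
  have fU: "finite U" using U by (rule linear_code_finite)
  have fH: "finite ?H" using H by (rule linear_code_finite)
  have cnt: "int (card {u \<in> W. \<mu> u \<noteq> 0}) = int (card W) - int (card (kernel_on W \<mu>))"
    if "finite W" for W
  proof -
    have "{u \<in> W. \<mu> u \<noteq> 0} = W - kernel_on W \<mu>" "kernel_on W \<mu> \<subseteq> W"
      by (auto simp: kernel_on_def)
    then show ?thesis
      using that by (simp add: card_Diff_subset finite_subset card_mono of_nat_diff)
  qed
  have cH: "card U = CARD('a) * card ?H" using U \<nu> ne by (rule card_kernel_on)
  consider (same) "kernel_on U \<mu> = ?H" | (zero) "kernel_on U \<mu> = U"
    | (other) "kernel_on U \<mu> \<noteq> ?H" "kernel_on U \<mu> \<noteq> U" by blast
  then show ?thesis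
  proof cases
    case same
    then have "kernel_on ?H \<mu> = ?H" by (auto simp: kernel_on_def)
    then show ?thesis using same by (simp add: cnt fU fH)
  next
    case zero
    then have "kernel_on ?H \<mu> = ?H" by (auto simp: kernel_on_def)
    then show ?thesis using zero ne by (simp add: cnt fU fH)
  next
    case other
    have c\<mu>: "card U = CARD('a) * card (kernel_on U \<mu>)" using U \<mu> other(2) by (rule card_kernel_on)
    \<comment> \<open>Otherwise one hyperplane would contain the other; having equal size, they
      would coincide.\<close>
    have "kernel_on ?H \<mu> \<noteq> ?H"
    proof
      assume "kernel_on ?H \<mu> = ?H"
      then have "?H \<subseteq> kernel_on U \<mu>" by (auto simp: kernel_on_def)
      moreover have "card ?H = card (kernel_on U \<mu>)" using cH c\<mu> by simp
      moreover have "finite (kernel_on U \<mu>)" using fU by (simp add: kernel_on_def)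
      ultimately show False using other(1) card_subset_eq by metis
    qed
    then have "card ?H = CARD('a) * card (kernel_on ?H \<mu>)" using H \<mu>H by (intro card_kernel_on)
    then have "int (card ?H) = int CARD('a) * int (card (kernel_on ?H \<mu>))"
      by (metis of_nat_mult)
    moreover have "int (card U) = int CARD('a) * int (card ?H)"
      "int (card U) = int CARD('a) * int (card (kernel_on U \<mu>))"
      using cH c\<mu> by (metis of_nat_mult)+
    ultimately show ?thesis using other by (simp add: cnt fU fH right_diff_distrib)
  qed
qed

lemma linear_functional_on_same_kernel:
  fixes U :: "'a :: field vec set"
  assumes U: "linear_code n U"
    and \<mu>: "linear_functional_on U \<mu>" and \<nu>: "linear_functional_on U \<nu>"
    and eq: "kernel_on U \<mu> = kernel_on U \<nu>"
  shows "\<exists>c. c \<noteq> 0 \<and> (\<forall>u\<in>U. \<nu> u = c * \<mu> u)"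
proof (cases "kernel_on U \<mu> = U")
  case True
  then have "\<forall>u\<in>U. \<mu> u = 0 \<and> \<nu> u = 0" using eq by (auto simp: kernel_on_def)
  then show ?thesis by (intro exI[of _ 1]) auto
next
  case False
  then obtain w where w: "w \<in> U" "\<mu> w \<noteq> 0" by (auto simp: kernel_on_def)
  have w': "\<nu> w \<noteq> 0" using w eq by (auto simp: kernel_on_def)
  have "\<nu> u = (\<nu> w / \<mu> w) * \<mu> u" if u: "u \<in> U" for u
  proof -
    \<comment> \<open>Chosen so that \<open>u + ?a w\<close> is killed by \<open>\<mu>\<close>,
      hence by \<open>\<nu>\<close>; this determines \<open>\<nu> u\<close> from
      \<open>\<nu> w\<close>.\<close>
    let ?a = "- (\<mu> u / \<mu> w)"
    have aw: "?a \<cdot>\<^sub>v w \<in> U" using U w unfolding linear_code_iff by blast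
    then have s: "u + ?a \<cdot>\<^sub>v w \<in> U" using U u unfolding linear_code_iff by blast
    have "\<mu> (u + ?a \<cdot>\<^sub>v w) = \<mu> u + ?a * \<mu> w" "\<nu> (u + ?a \<cdot>\<^sub>v w) = \<nu> u + ?a * \<nu> w"
      using \<mu> \<nu> aw u w(1) unfolding linear_functional_on_def by metis+
    moreover from this(1) have "u + ?a \<cdot>\<^sub>v w \<in> kernel_on U \<mu>" using s w by (simp add: kernel_on_def)
    then have "u + ?a \<cdot>\<^sub>v w \<in> kernel_on U \<nu>" using eq by simp
    then have "\<nu> (u + ?a \<cdot>\<^sub>v w) = 0" by (simp add: kernel_on_def)
    ultimately have "\<nu> u + ?a * \<nu> w = 0" by simp
    then show ?thesis using w by (simp add: field_simps eq_neg_iff_add_eq_0)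
  qed
  moreover have "\<nu> w / \<mu> w \<noteq> 0" using w w' by simp
  ultimately show ?thesis by blast
qed

section \<open>Sorted sums and the split difference\<close>

text \<open>The initial segment of a sorted list has the least sum among submultisets of its size.
  The induction pairs the head \<open>x\<close> with some \<open>y \<ge> x\<close> of
  \<open>M\<close> whose removal leaves a submultiset of the tail.\<close>

lemma sorted_take_sum_le:
  fixes xs :: "int list"
  assumes "sorted xs" "M \<subseteq># mset xs"
  shows "sum_list (take (size M) xs) \<le> sum_mset M"
  using assms
proof (induction xs arbitrary: M)
  case Nil
  then show ?case by simp
next
  case (Cons x xs)
  show ?case
  proof (cases "M = {#}")
    case True
    then show ?thesis by simp
  next
    case False
    \<comment> \<open>If \<open>x\<close> occurs in \<open>M\<close>, take \<open>y = x\<close>; if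
      not, \<open>M\<close> lies wholly in the tail and any element of it will do.\<close>
    have "\<exists>y. y \<in># M \<and> x \<le> y \<and> M - {#y#} \<subseteq># mset xs"
    proof (cases "x \<in># M")
      case True
      then have "M - {#x#} \<subseteq># mset xs"
        using Cons.prems(2) by (simp add: subset_eq_diff_conv)
      with True show ?thesis by blast
    next
      case x: False
      obtain y where y: "y \<in># M" using \<open>M \<noteq> {#}\<close> by blast
      have "M \<subseteq># mset xs"
        using Cons.prems(2) x by (metis diff_single_trivial mset.simps(2) subset_eq_diff_conv add_mset_add_single)
      then have "M - {#y#} \<subseteq># mset xs"
        using diff_subset_eq_self subset_mset.order_trans by blast
      moreover have "y \<in> set xs"
        using \<open>M \<subseteq># mset xs\<close> y by (auto dest: mset_subset_eqD)
      ultimately have "M - {#y#} \<subseteq># mset xs" "y \<in> set xs" by simp_all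
      with y Cons.prems(1) show ?thesis by auto
    qed
    then obtain y where y: "y \<in># M" "x \<le> y" "M - {#y#} \<subseteq># mset xs" by blast
    define N where "N = M - {#y#}"
    have M: "M = add_mset y N" using y by (simp add: N_def)
    have "sum_list (take (size N) xs) \<le> sum_mset N"
      using Cons y by (simp add: N_def)
    then show ?thesis using y by (simp add: M)
  qed
qed

text \<open>The split difference puts the smallest values into the positive part. Since the total
  over \<open>P\<close> is fixed, any other choice of \<open>A\<close> of that size has a sum at
  least as large, and its complement a sum at most as large; the latter enters with the factor
  \<open>-(q - 1) \<le> 0\<close>.\<close>

lemma split_difference_le:
  assumes P: "finite P" and AP: "A \<subseteq> P" and cA: "card A = q ^ (k - 1)"
    and cP: "card P = (q ^ k - 1) div (q - 1)" and q: "q > 0"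
  shows "split_difference q k (image_mset g (mset_set P))
    \<le> sum g A - (int q - 1) * sum g (P - A)"
proof -
  define xs where "xs = sorted_list_of_multiset (image_mset g (mset_set P))"
  define N where "N = (q ^ k - 1) div (q - 1)"
  have mset: "mset xs = image_mset g (mset_set P)" by (simp add: xs_def)
  have len: "length xs = N" using arg_cong[OF mset, of size] cP by (simp add: N_def)
  have le: "q ^ (k - 1) \<le> N" using card_mono[OF P AP] cA cP by (simp add: N_def)
  have fA: "finite A" using AP P by (rule finite_subset)
  have tot: "sum_list xs = sum g P"
    using arg_cong[OF mset, of sum_mset] by (simp add: sum_mset_sum_list sum_unfold_sum_mset)
  have "(\<Sum>i = 0..<q ^ (k - 1). xs ! i) = sum_list (take (q ^ (k - 1)) xs)"
    using len le by (simp add: sum_list_sum_nth)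
  also have "\<dots> \<le> sum_mset (image_mset g (mset_set A))"
    using sorted_take_sum_le[of xs "image_mset g (mset_set A)"] AP P fA cA
    by (simp add: mset image_mset_subseteq_mono subset_imp_msubset_mset_set)
      (simp add: xs_def)
  finally have low: "(\<Sum>i = 0..<q ^ (k - 1). xs ! i) \<le> sum g A"
    by (simp add: sum_unfold_sum_mset)
  have "sum g P = (\<Sum>i = 0..<q ^ (k - 1). xs ! i) + (\<Sum>i = q ^ (k - 1)..<N. xs ! i)"
    using le by (simp add: tot[symmetric] sum_list_sum_nth len sum.atLeastLessThan_concat)
  moreover have "sum g P = sum g A + sum g (P - A)"
    using sum.subset_diff[OF AP P, of g] by simp
  moreover have "split_difference q k (image_mset g (mset_set P)) = (\<Sum>i = 0..<q ^ (k - 1). xs ! i)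
      - (int q - 1) * (\<Sum>i = q ^ (k - 1)..<N. xs ! i)"
    by (simp add: split_difference_def xs_def N_def Let_def)
  moreover have "(int q - 1) * sum g (P - A) \<le> (int q - 1) * (\<Sum>i = q ^ (k - 1)..<N. xs ! i)"
    using q calculation low by (intro mult_left_mono) auto
  ultimately show ?thesis using low by linarith
qed

section \<open>Projective points and sums over them\<close>

lemma equiv_proj_rel:
  fixes U :: "'a :: field vec set"
  shows "equiv (U - {0\<^sub>v n}) (proj_rel n U)"
proof (rule equivI)
  show "refl_on (U - {0\<^sub>v n}) (proj_rel n U)"
    by (auto simp: refl_on_def proj_rel_def intro: exI[of _ 1])
  show "proj_rel n U \<subseteq> (U - {0\<^sub>v n}) \<times> (U - {0\<^sub>v n})"
    by (auto simp: proj_rel_def)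
  show "sym (proj_rel n U)"
  proof (rule symI)
    fix x y assume "(x, y) \<in> proj_rel n U"
    then obtain a where "x \<in> U - {0\<^sub>v n}" "y \<in> U - {0\<^sub>v n}" "a \<noteq> 0" "x = a \<cdot>\<^sub>v y"
      unfolding proj_rel_def by blast
    moreover from this have "y = inverse a \<cdot>\<^sub>v x" "inverse a \<noteq> 0"
      by (simp_all add: smult_smult_assoc)
    ultimately show "(y, x) \<in> proj_rel n U"
      unfolding proj_rel_def by blast
  qed
  show "trans (proj_rel n U)"
  proof (rule transI)
    fix x y z assume "(x, y) \<in> proj_rel n U" "(y, z) \<in> proj_rel n U"
    then obtain a b where "x \<in> U - {0\<^sub>v n}" "z \<in> U - {0\<^sub>v n}" "a \<noteq> 0" "b \<noteq> 0"
      "x = a \<cdot>\<^sub>v y" "y = b \<cdot>\<^sub>v z"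
      unfolding proj_rel_def by blast
    moreover from this have "x = (a * b) \<cdot>\<^sub>v z" "a * b \<noteq> 0"
      by (simp_all add: smult_smult_assoc)
    ultimately show "(x, z) \<in> proj_rel n U"
      unfolding proj_rel_def by blast
  qed
qed

text \<open>A class is the set of nonzero multiples of one vector \<open>x\<close>. Distinct scalars
  give distinct multiples, as a nonzero coordinate of \<open>x\<close> shows.\<close>

lemma card_proj_class:
  fixes U :: "'a :: {field, finite} vec set"
  assumes U: "linear_code n U" and C: "C \<in> proj_points n U"
  shows "card C = CARD('a) - 1"
proof -
  from C obtain x where x: "x \<in> U" "x \<noteq> 0\<^sub>v n" and Cx: "C = proj_rel n U `` {x}"
    by (auto simp: proj_points_def quotient_def)
  have xc: "x \<in> carrier_vec n" using U x by (auto simp: linear_code_iff)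
  obtain i where i: "i < n" "x $ i \<noteq> 0"
    using x xc by (metis eq_vecI carrier_vecD index_zero_vec)
  have nz: "a \<cdot>\<^sub>v x \<noteq> 0\<^sub>v n" if "a \<noteq> 0" for a
  proof
    assume "a \<cdot>\<^sub>v x = 0\<^sub>v n"
    then have "(a \<cdot>\<^sub>v x) $ i = 0" using i by simp
    then show False using i that xc by auto
  qed
  have inj: "inj_on (\<lambda>a. a \<cdot>\<^sub>v x) (UNIV - {0})"
  proof (rule inj_onI)
    fix a b assume "a \<cdot>\<^sub>v x = b \<cdot>\<^sub>v x"
    then have "(a \<cdot>\<^sub>v x) $ i = (b \<cdot>\<^sub>v x) $ i" by simp
    then show "a = b" using i xc by auto
  qed
  have "C = (\<lambda>a. a \<cdot>\<^sub>v x) ` (UNIV - {0})"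
  proof (intro equalityI subsetI)
    fix y assume "y \<in> C"
    then obtain a where "a \<noteq> 0" "x = a \<cdot>\<^sub>v y" by (auto simp: Cx proj_rel_def)
    then show "y \<in> (\<lambda>a. a \<cdot>\<^sub>v x) ` (UNIV - {0})"
      by (intro image_eqI[of _ _ "inverse a"]) (auto simp: smult_smult_assoc)
  next
    fix y assume "y \<in> (\<lambda>a. a \<cdot>\<^sub>v x) ` (UNIV - {0})"
    then obtain a where a: "a \<noteq> 0" "y = a \<cdot>\<^sub>v x" by auto
    then have "y \<in> U" using U x by (simp add: linear_code_iff)
    moreover have "y \<noteq> 0\<^sub>v n" using a nz by simp
    moreover have "x = inverse a \<cdot>\<^sub>v y" using a by (simp add: smult_smult_assoc)
    moreover have "inverse a \<noteq> 0" using a by simp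
    ultimately have "(x, y) \<in> proj_rel n U" using x unfolding proj_rel_def by blast
    then show "y \<in> C" by (simp add: Cx)
  qed
  then show ?thesis using card_image[OF inj] by (simp add: card_Diff_singleton)
qed

text \<open>The classes partition the nonzero vectors into blocks of \<open>CARD('a) - 1\<close>
  elements on which \<open>h\<close> is constant. This moves counts and weight sums between vectors
  and projective points.\<close>

lemma sum_over_proj_points:
  fixes U :: "'a :: {field, finite} vec set" and h :: "'a vec \<Rightarrow> int"
  assumes U: "linear_code n U"
    and h: "\<And>a u. a \<noteq> 0 \<Longrightarrow> u \<in> U \<Longrightarrow> h (a \<cdot>\<^sub>v u) = h u"
    and rep: "\<And>C. C \<in> proj_points n U \<Longrightarrow> rep C \<in> C"
  shows "(\<Sum>u\<in>U - {0\<^sub>v n}. h u) = (int CARD('a) - 1) * (\<Sum>C\<in>proj_points n U. h (rep C))"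
proof -
  let ?P = "proj_points n U"
  have un: "U - {0\<^sub>v n} = \<Union>?P"
    unfolding proj_points_def using Union_quotient[OF equiv_proj_rel] by metis
  have fU: "finite (U - {0\<^sub>v n})" using linear_code_finite[OF U] by simp
  have "(\<Sum>u\<in>U - {0\<^sub>v n}. h u) = (\<Sum>C\<in>?P. \<Sum>u\<in>C. h u)"
    unfolding un
  proof (subst sum.Union_disjoint)
    show "\<forall>A\<in>?P. finite A" using fU un by (metis Union_upper finite_subset)
    show "\<forall>A\<in>?P. \<forall>B\<in>?P. A \<noteq> B \<longrightarrow> A \<inter> B = {}"
      unfolding proj_points_def using quotient_disj[OF equiv_proj_rel] by metis
  qed simp
  also have "\<dots> = (\<Sum>C\<in>?P. (int CARD('a) - 1) * h (rep C))"
  proof (rule sum.cong[OF refl])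
    fix C assume C: "C \<in> ?P"
    have "h u = h (rep C)" if "u \<in> C" for u
    proof -
      have "(u, rep C) \<in> proj_rel n U"
        using that C rep[OF C] quotient_eq_iff[OF equiv_proj_rel, of C U n C u "rep C"]
        by (simp add: proj_points_def)
      then show ?thesis using h by (auto simp: proj_rel_def)
    qed
    then have "(\<Sum>u\<in>C. h u) = int (card C) * h (rep C)" by simp
    then show "(\<Sum>u\<in>C. h u) = (int CARD('a) - 1) * h (rep C)"
      using card_proj_class[OF U C] by (simp add: of_nat_diff Suc_leI)
  qed
  finally show ?thesis by (simp add: sum_distrib_left)
qed

section \<open>Matching of coordinates and total Hamming weights\<close>

text \<open>Each fibre of \<open>h\<close> is injected into the fibre of \<open>g\<close> over the
  same value. Fibres over different values are disjoint, so the pieces glue to one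
  injection.\<close>

lemma exists_fibrewise_injection:
  assumes I: "finite I" and J: "finite J"
    and le: "\<And>j. j \<in> J \<Longrightarrow> card {i \<in> J. h i = h j} \<le> card {i \<in> I. g i = h j}"
  shows "\<exists>\<sigma>. inj_on \<sigma> J \<and> (\<forall>j\<in>J. \<sigma> j \<in> I \<and> g (\<sigma> j) = h j)"
proof -
  have "\<exists>f. inj_on f {i \<in> J. h i = h j} \<and> f ` {i \<in> J. h i = h j} \<subseteq> {i \<in> I. g i = h j}"
    if "j \<in> J" for j
  proof -
    have "finite {i \<in> J. h i = h j}" "finite {i \<in> I. g i = h j}" using I J by simp_all
    from card_le_inj[OF this le[OF that]] show ?thesis by blast
  qed
  \<comment> \<open>Indexing by the value \<open>k\<close> rather than by \<open>j\<close> makes all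
    members of a fibre share one injection.\<close>
  then have "\<forall>k\<in>h ` J. \<exists>f. inj_on f {i \<in> J. h i = k} \<and> f ` {i \<in> J. h i = k} \<subseteq> {i \<in> I. g i = k}"
    by (simp only: ball_simps) (rule ballI)
  from bchoice[OF this] obtain F where F: "\<And>k. k \<in> h ` J \<Longrightarrow> inj_on (F k) {i \<in> J. h i = k}"
    "\<And>k. k \<in> h ` J \<Longrightarrow> F k ` {i \<in> J. h i = k} \<subseteq> {i \<in> I. g i = k}"
    by auto
  have mem: "F (h j) j \<in> I \<and> g (F (h j) j) = h j" if "j \<in> J" for j
    using F(2)[of "h j"] that by blast
  have "inj_on (\<lambda>j. F (h j) j) J"
  proof (rule inj_onI)
    fix i j assume ij: "i \<in> J" "j \<in> J" "F (h i) i = F (h j) j"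
    then have "h i = h j" using mem by metis
    then show "i = j" using F(1)[of "h j"] ij by (auto dest: inj_onD)
  qed
  with mem show ?thesis by blast
qed

lemma hamming_weight_sum:
  assumes "v \<in> carrier_vec n"
  shows "int (hamming_weight v) = (\<Sum>i<n. if v $ i \<noteq> 0 then 1 else 0)"
proof -
  have "{i. i < dim_vec v \<and> v $ i \<noteq> 0} = {..<n} \<inter> {i. v $ i \<noteq> 0}" using assms by auto
  then show ?thesis by (simp add: hamming_weight_def sum.If_cases)
qed

text \<open>Interchanging the sums over vectors and coordinates reduces this to
  \<open>nonvanishing_count_balance\<close> for each coordinate. The map \<open>f\<close> is kept
  general in order to cover both the identity and \<open>\<phi>\<close>.\<close>

lemma sum_hamming_weight_balance:
  fixes U :: "'a :: {field, finite} vec set"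
  assumes U: "linear_code n U"
    and f: "\<And>u. u \<in> U \<Longrightarrow> f u \<in> carrier_vec m"
    and lin: "\<And>i. i < m \<Longrightarrow> linear_functional_on U (\<lambda>u. f u $ i)"
    and \<nu>: "linear_functional_on U \<nu>" and ne: "kernel_on U \<nu> \<noteq> U"
  shows "(\<Sum>u\<in>U. int (hamming_weight (f u)))
      - int CARD('a) * (\<Sum>u\<in>kernel_on U \<nu>. int (hamming_weight (f u)))
    = (int (card U) - int (card (kernel_on U \<nu>)))
      * int (card {i \<in> {..<m}. kernel_on U (\<lambda>u. f u $ i) = kernel_on U \<nu>})"
proof -
  let ?H = "kernel_on U \<nu>"
  have fU: "finite U" using U by (rule linear_code_finite)
  have HU: "?H \<subseteq> U" by (auto simp: kernel_on_def)
  have sw: "(\<Sum>u\<in>W. int (hamming_weight (f u))) = (\<Sum>i<m. int (card {u \<in> W. f u $ i \<noteq> 0}))"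
    if "W \<subseteq> U" for W
  proof -
    have fW: "finite W" using that fU by (rule finite_subset)
    have "(\<Sum>u\<in>W. int (hamming_weight (f u))) = (\<Sum>u\<in>W. \<Sum>i<m. if f u $ i \<noteq> 0 then 1 else 0)"
      using that f by (intro sum.cong refl hamming_weight_sum) auto
    also have "\<dots> = (\<Sum>i<m. \<Sum>u\<in>W. if f u $ i \<noteq> 0 then 1 else 0)" by (rule sum.swap)
    also have "\<dots> = (\<Sum>i<m. int (card {u \<in> W. f u $ i \<noteq> 0}))"
      using fW by (simp add: sum.If_cases Int_def)
    finally show ?thesis .
  qed
  have "(\<Sum>u\<in>U. int (hamming_weight (f u))) - int CARD('a) * (\<Sum>u\<in>?H. int (hamming_weight (f u)))
    = (\<Sum>i<m. int (card {u \<in> U. f u $ i \<noteq> 0}) - int CARD('a) * int (card {u \<in> ?H. f u $ i \<noteq> 0}))"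
    by (simp add: sw[OF subset_refl] sw[OF HU] sum_subtractf sum_distrib_left)
  also have "\<dots> = (\<Sum>i<m. if kernel_on U (\<lambda>u. f u $ i) = ?H then int (card U) - int (card ?H) else 0)"
    by (intro sum.cong refl nonvanishing_count_balance[OF U lin \<nu> ne]) auto
  also have "\<dots> = (int (card U) - int (card ?H)) * int (card {i \<in> {..<m}. kernel_on U (\<lambda>u. f u $ i) = ?H})"
    by (simp add: sum.If_cases Int_def mult.commute)
  finally show ?thesis .
qed

lemma code_mapD:
  fixes U :: "'a :: field vec set"
  assumes "code_map n U m V \<phi>"
  shows "linear_code n U" "linear_code m V"
    and "\<And>u. u \<in> U \<Longrightarrow> \<phi> u \<in> V"
    and "\<And>u v. u \<in> U \<Longrightarrow> v \<in> U \<Longrightarrow> \<phi> (u + v) = \<phi> u + \<phi> v"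
    and "\<And>a u. u \<in> U \<Longrightarrow> \<phi> (a \<cdot>\<^sub>v u) = a \<cdot>\<^sub>v \<phi> u"
proof -
  have hom: "\<phi> \<in> LinearCombinations.module_hom class_ring
        (module_vec TYPE('a) n\<lparr>carrier := U\<rparr>) (module_vec TYPE('a) m\<lparr>carrier := V\<rparr>)"
    using assms by (auto simp: code_map_def linear_map_def mod_hom_def mod_hom_axioms_def)
  show "linear_code n U" "linear_code m V" using assms by (auto simp: code_map_def)
  show "\<And>u. u \<in> U \<Longrightarrow> \<phi> u \<in> V"
    and "\<And>u v. u \<in> U \<Longrightarrow> v \<in> U \<Longrightarrow> \<phi> (u + v) = \<phi> u + \<phi> v"
    and "\<And>a u. u \<in> U \<Longrightarrow> \<phi> (a \<cdot>\<^sub>v u) = a \<cdot>\<^sub>v \<phi> u"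
    using hom by (auto simp: LinearCombinations.module_hom_def module_vec_def)
qed

section \<open>Building the projection matrix\<close>

lemma is_projection_if_fibres_le:
  fixes U :: "'a :: field vec set"
  assumes \<phi>: "code_map n U m V \<phi>"
    and le: "\<And>j. j < m \<Longrightarrow> kernel_on U (\<lambda>u. \<phi> u $ j) \<noteq> U \<Longrightarrow>
      card {i \<in> {..<m}. kernel_on U (\<lambda>u. \<phi> u $ i) = kernel_on U (\<lambda>u. \<phi> u $ j)}
      \<le> card {i \<in> {..<n}. kernel_on U (\<lambda>u. u $ i) = kernel_on U (\<lambda>u. \<phi> u $ j)}"
    and lin: "\<And>i. i < n \<Longrightarrow> linear_functional_on U (\<lambda>u. u $ i)"
      "\<And>j. j < m \<Longrightarrow> linear_functional_on U (\<lambda>u. \<phi> u $ j)"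
  shows "is_projection n U m \<phi>"
proof -
  note U = code_mapD(1)[OF \<phi>]
  let ?K = "\<lambda>j. kernel_on U (\<lambda>u. \<phi> u $ j)"
  \<comment> \<open>Output coordinates vanishing on \<open>U\<close> are left out: they become zero
    rows, and the hypothesis gives no bound for them.\<close>
  define J where "J = {j. j < m \<and> ?K j \<noteq> U}"
  have J: "{i \<in> J. ?K i = ?K j} = {i \<in> {..<m}. ?K i = ?K j}" if "j \<in> J" for j
    using that by (auto simp: J_def)
  have "\<exists>\<sigma>. inj_on \<sigma> J \<and> (\<forall>j\<in>J. \<sigma> j \<in> {..<n} \<and> kernel_on U (\<lambda>u. u $ \<sigma> j) = ?K j)"
  proof (rule exists_fibrewise_injection)
    fix j assume "j \<in> J"
    then show "card {i \<in> J. ?K i = ?K j} \<le> card {i \<in> {..<n}. kernel_on U (\<lambda>u. u $ i) = ?K j}"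
      unfolding J[OF \<open>j \<in> J\<close>] by (intro le) (auto simp: J_def)
  qed (auto simp: J_def)
  then obtain \<sigma> where inj: "inj_on \<sigma> J"
    and \<sigma>: "\<And>j. j \<in> J \<Longrightarrow> \<sigma> j < n" "\<And>j. j \<in> J \<Longrightarrow> kernel_on U (\<lambda>u. u $ \<sigma> j) = ?K j"
    by auto
  have "\<forall>j\<in>J. \<exists>c. c \<noteq> 0 \<and> (\<forall>u\<in>U. \<phi> u $ j = c * u $ \<sigma> j)"
    using linear_functional_on_same_kernel[OF U lin(1) lin(2)] \<sigma> by (auto simp: J_def)
  then obtain c where c: "\<And>j u. j \<in> J \<Longrightarrow> u \<in> U \<Longrightarrow> \<phi> u $ j = c j * u $ \<sigma> j"
    by metis
  \<comment> \<open>Row \<open>j\<close> has its only possible nonzero entry in the matched column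
    \<open>\<sigma> j\<close>; injectivity of \<open>\<sigma>\<close> on \<open>J\<close> then
    bounds the columns as well.\<close>
  define A where "A = mat m n (\<lambda>(j, i). if j \<in> J \<and> i = \<sigma> j then c j else 0)"
  have A: "A \<in> carrier_mat m n" by (simp add: A_def)
  have rows: "card {i. i < n \<and> A $$ (j, i) \<noteq> 0} \<le> 1" if "j < m" for j
  proof -
    have "{i. i < n \<and> A $$ (j, i) \<noteq> 0} \<subseteq> {\<sigma> j}" using that by (auto simp: A_def split: if_splits)
    then show ?thesis using card_mono[of "{\<sigma> j}"] by fastforce
  qed
  have cols: "card {j. j < m \<and> A $$ (j, i) \<noteq> 0} \<le> 1" if "i < n" for i
  proof -
    have "\<forall>x\<in>{j. j < m \<and> A $$ (j, i) \<noteq> 0}. \<forall>y\<in>{j. j < m \<and> A $$ (j, i) \<noteq> 0}. x = y"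
      using that inj by (auto simp: A_def inj_on_def split: if_splits)
    then show ?thesis by (simp add: card_le_Suc0_iff_eq)
  qed
  have act: "\<phi> u = A *\<^sub>v u" if u: "u \<in> U" for u
  proof (rule eq_vecI)
    have uc: "u \<in> carrier_vec n" using U u by (auto simp: linear_code_iff)
    have \<phi>u: "\<phi> u \<in> carrier_vec m"
      using code_mapD(2,3)[OF \<phi>] u by (auto simp: linear_code_iff)
    then show "dim_vec (\<phi> u) = dim_vec (A *\<^sub>v u)" using A by auto
    fix j assume "j < dim_vec (A *\<^sub>v u)"
    then have j: "j < m" using A by auto
    have "(A *\<^sub>v u) $ j = (\<Sum>i = 0..<n. (if j \<in> J \<and> i = \<sigma> j then c j else 0) * u $ i)"
      using A uc j by (auto simp: scalar_prod_def A_def intro!: sum.cong)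
    also have "\<dots> = (if j \<in> J then c j * u $ \<sigma> j else 0)"
      using \<sigma>(1) by (auto simp: if_distrib[of "\<lambda>x. x * _"] cong: if_cong)
    also have "\<dots> = \<phi> u $ j"
    proof (cases "j \<in> J")
      case False
      then have "?K j = U" using j by (simp add: J_def)
      then have "\<phi> u $ j = 0" using u by (auto simp: kernel_on_def)
      then show ?thesis using False by simp
    qed (simp add: c u)
    finally show "\<phi> u $ j = (A *\<^sub>v u) $ j" by simp
  qed
  show ?thesis
    unfolding is_projection_def using A rows cols act by blast
qed

section \<open>Weight changes compared with the split difference\<close>

theorem theorem1p13:
  fixes q k :: nat and S :: "int multiset"
  assumes "q = CARD('a :: {field, finite})"
    and "k > 0"
    and "size S = (q ^ k - 1) div (q - 1)"
    and "split_difference q k S > - (int q ^ (k - 1))"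
  shows "projection_forcing TYPE('a) S"
  unfolding projection_forcing_def
proof (intro allI impI)
  fix n m and U V :: "'a vec set" and \<phi>
  assume \<phi>: "code_map n U m V \<phi>" and S: "realizes n U \<phi> S"
  note U = code_mapD(1)[OF \<phi>]
  let ?P = "proj_points n U" and ?c = "weight_change \<phi>"
  have q2: "q \<ge> 2"
  proof -
    have "card {0, 1 :: 'a} \<le> CARD('a)" by (intro card_mono) auto
    then show ?thesis using assms(1) by simp
  qed
  have fU: "finite U" using U by (rule linear_code_finite)
  have fP: "finite ?P" using U by (rule finite_proj_points)
  have Uc: "u \<in> carrier_vec n" if "u \<in> U" for u using U that by (auto simp: linear_code_iff)
  have \<phi>c: "\<phi> u \<in> carrier_vec m" if "u \<in> U" for u
    using code_mapD(2,3)[OF \<phi>] that by (auto simp: linear_code_iff)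
  have zU: "0\<^sub>v n \<in> U" using U by (simp add: linear_code_iff)
  have lin1: "linear_functional_on U (\<lambda>u. u $ i)" if "i < n" for i
    unfolding linear_functional_on_def using that by (auto dest!: Uc)
  have lin2: "linear_functional_on U (\<lambda>u. \<phi> u $ j)" if "j < m" for j
    unfolding linear_functional_on_def using that
    by (auto simp: code_mapD(4,5)[OF \<phi>] dest!: \<phi>c)
  have c_smult: "?c (a \<cdot>\<^sub>v u) = ?c u" if "a \<noteq> 0" "u \<in> U" for a u
    using that by (simp add: weight_change_def hamming_weight_smult code_mapD(5)[OF \<phi>])
  \<comment> \<open>The zero vector has weight change 0, so later sums may include or omit it
    freely.\<close>
  have "\<phi> (0 \<cdot>\<^sub>v 0\<^sub>v n) = 0 \<cdot>\<^sub>v \<phi> (0\<^sub>v n)" using zU by (rule code_mapD(5)[OF \<phi>])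
  then have "\<phi> (0\<^sub>v n) = 0\<^sub>v m" 
    using zero_smult_carrier_vec[OF \<phi>c[OF zU]] zero_smult_carrier_vec[OF zero_carrier_vec, of n]
    by metis
  moreover have "hamming_weight (0\<^sub>v l :: 'a vec) = 0" for l
    by (auto simp: hamming_weight_def)
  ultimately have c0: "?c (0\<^sub>v n) = 0" by (simp add: weight_change_def)

  define rep where "rep C = (SOME u. u \<in> C)" for C :: "'a vec set"
  have rep: "rep C \<in> C" if "C \<in> ?P" for C
  proof -
    have "C \<noteq> {}"
      using in_quotient_imp_non_empty[OF equiv_proj_rel] that unfolding proj_points_def by blast
    then show ?thesis by (simp add: rep_def some_in_eq)
  qed
  have S_eq: "S = image_mset (\<lambda>C. ?c (rep C)) (mset_set ?P)"
  proof -
    have "S = image_mset (\<lambda>C. the_elem (?c ` C)) (mset_set ?P)"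
      using S by (simp add: realizes_def weight_changes_def)
    also have "\<dots> = image_mset (\<lambda>C. ?c (rep C)) (mset_set ?P)"
      using fP by (intro image_mset_cong weight_change_class[OF \<phi>] rep) simp_all
    finally show ?thesis .
  qed
  note sumP = sum_over_proj_points[OF U _ rep, folded assms(1)]
  have cP: "card ?P = (q ^ k - 1) div (q - 1)" using assms(3) by (simp add: S_eq)
  \<comment> \<open>The size of \<open>S\<close> is the number of projective points; with
    \<open>q - 1\<close> vectors per point and the zero vector it forces \<open>U\<close> to have
    dimension \<open>k\<close>.\<close>
  have "int (card U) = int (q ^ k)"
  proof -
    have "int (card (U - {0\<^sub>v n})) = (int q - 1) * int (card ?P)"
      using sumP[of "\<lambda>_. 1"] by simp
    moreover have "int (card (U - {0\<^sub>v n})) = int (card U) - 1"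
      using card_Suc_Diff1[OF fU zU] by linarith
    moreover have "(int q - 1) * int (card ?P) = int (q ^ k) - 1"
    proof -
      have q1: "int (q - 1) = int q - 1" and qk: "int (q ^ k - 1) = int q ^ k - 1"
        using q2 by (simp_all add: of_nat_diff)
      \<comment> \<open>The natural-number division in the size of \<open>S\<close> is exact by the
        geometric series.\<close>
      have "int (q - 1) dvd int (q ^ k - 1)"
        unfolding q1 qk by (simp add: power_diff_1_eq)
      then have "(q - 1) * card ?P = q ^ k - 1" unfolding cP int_dvd_int_iff by simp
      then have "int (q - 1) * int (card ?P) = int (q ^ k - 1)" by (metis of_nat_mult)
      then show ?thesis unfolding q1 qk by simp
    qed
    ultimately show ?thesis by simp
  qed
  then have "card U = q ^ k" by (simp only: of_nat_eq_iff)
  then have cU: "card U = q * q ^ (k - 1)" using assms(2) by (cases k) simp_all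

  show "is_projection n U m \<phi>"
  proof (rule is_projection_if_fibres_le[OF \<phi> _ lin1 lin2])
    fix j assume j: "j < m" and ne: "kernel_on U (\<lambda>u. \<phi> u $ j) \<noteq> U"
    \<comment> \<open>For the hyperplane \<open>H\<close> on which output coordinate
      \<open>j\<close> vanishes, \<open>a\<close> and \<open>b\<close> count the input and output
      coordinates with kernel \<open>H\<close>. The goal is \<open>b \<le> a\<close>.\<close>
    define \<nu> where "\<nu> = (\<lambda>u. \<phi> u $ j)"
    define H where "H = kernel_on U \<nu>"
    define a where "a = card {i \<in> {..<n}. kernel_on U (\<lambda>u. u $ i) = H}"
    define b where "b = card {i \<in> {..<m}. kernel_on U (\<lambda>u. \<phi> u $ i) = H}"
    have \<nu>: "linear_functional_on U \<nu>" and neH: "kernel_on U \<nu> \<noteq> U"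
      using lin2 j ne by (auto simp: \<nu>_def)
    have HU: "H \<subseteq> U" by (auto simp: H_def kernel_on_def)
    have zH: "0\<^sub>v n \<in> H" using linear_code_kernel_on[OF U \<nu>] by (simp add: H_def linear_code_iff)
    have "card U = q * card H"
      unfolding H_def assms(1) using U \<nu> neH by (rule card_kernel_on)
    then have cH: "card H = q ^ (k - 1)" using cU q2 by simp
    have UH: "int (card U) - int (card H) = (int q - 1) * int q ^ (k - 1)"
      by (simp add: cU cH left_diff_distrib)
    \<comment> \<open>The balance for \<open>\<phi>\<close> is subtracted from the balance for the
      identity; both carry the factor \<open>card U - card H\<close>.\<close>
    have bal: "(\<Sum>u\<in>U. ?c u) - int q * (\<Sum>u\<in>H. ?c u)
        = (int q - 1) * (int q ^ (k - 1) * (int a - int b))"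
      using sum_hamming_weight_balance[OF U Uc lin1 \<nu> neH]
        sum_hamming_weight_balance[OF U \<phi>c lin2 \<nu> neH] UH
      unfolding weight_change_def a_def b_def H_def assms(1)[symmetric]
      by (simp add: sum_subtractf algebra_simps)
    \<comment> \<open>Membership in \<open>H\<close> depends only on the projective class, so
      testing it at \<open>rep C\<close> is legitimate.\<close>
    have inH: "x \<cdot>\<^sub>v u \<in> H \<longleftrightarrow> u \<in> H" if "x \<noteq> 0" "u \<in> U" for x u
      using that \<nu> U by (simp add: H_def kernel_on_def linear_functional_on_def linear_code_iff)
    define A where "A = {C \<in> ?P. rep C \<notin> H}"
    have AP: "A \<subseteq> ?P" by (auto simp: A_def)
    have PA: "?P - A = {C \<in> ?P. rep C \<in> H}" by (auto simp: A_def)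
    \<comment> \<open>The \<open>(q - 1) * q ^ (k - 1)\<close> vectors outside \<open>H\<close> are
      counted by classes, via the indicator of the complement of \<open>H\<close>.\<close>
    have cA: "card A = q ^ (k - 1)"
    proof -
      have "(\<Sum>u\<in>U - {0\<^sub>v n}. if u \<notin> H then 1 else 0 :: int)
        = (int q - 1) * (\<Sum>C\<in>?P. if rep C \<notin> H then 1 else 0)"
        by (rule sumP) (auto simp: inH)
      moreover have "(\<Sum>C\<in>?P. if rep C \<notin> H then 1 else 0) = int (card A)"
        using fP by (simp add: sum.If_cases A_def Int_def)
      moreover have "(\<Sum>u\<in>U - {0\<^sub>v n}. if u \<notin> H then 1 else 0 :: int) = int (card (U - H))"
      proof -
        have "(U - {0\<^sub>v n}) \<inter> {u. u \<notin> H} = U - H" using zH by auto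
        then show ?thesis using fU by (simp add: sum.If_cases)
      qed
      moreover have "int (card (U - H)) = int (card U) - int (card H)"
        using HU fU by (simp add: card_Diff_subset finite_subset of_nat_diff card_mono)
      ultimately have "(int q - 1) * int (card A) = (int q - 1) * int q ^ (k - 1)"
        using UH by metis
      then have "int (card A) = int (q ^ (k - 1))" using q2 by simp
      then show ?thesis by linarith
    qed
    have "(\<Sum>u\<in>U. ?c u) = (\<Sum>u\<in>U - {0\<^sub>v n}. ?c u)"
      using fU zU c0 by (simp add: sum.remove)
    also have "\<dots> = (int q - 1) * (\<Sum>C\<in>?P. ?c (rep C))"
      by (rule sumP) (auto simp: c_smult)
    finally have sU: "(\<Sum>u\<in>U. ?c u) = (int q - 1) * (\<Sum>C\<in>?P. ?c (rep C))" .
    have "(\<Sum>u\<in>H. ?c u) = (\<Sum>u\<in>U - {0\<^sub>v n}. if u \<in> H then ?c u else 0)"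
      using fU HU c0 by (intro sum.mono_neutral_cong) (auto intro: finite_subset)
    also have "\<dots> = (int q - 1) * (\<Sum>C\<in>?P. if rep C \<in> H then ?c (rep C) else 0)"
      by (rule sumP) (auto simp: c_smult inH)
    also have "(\<Sum>C\<in>?P. if rep C \<in> H then ?c (rep C) else 0) = (\<Sum>C\<in>?P - A. ?c (rep C))"
      using fP by (simp add: sum.If_cases PA Int_def)
    finally have sH: "(\<Sum>u\<in>H. ?c u) = (int q - 1) * (\<Sum>C\<in>?P - A. ?c (rep C))" .
    \<comment> \<open>Cancelling \<open>q - 1\<close> and splitting the sum over all points along
      \<open>A\<close> leaves the sum over \<open>A\<close> minus \<open>q - 1\<close> times the sum
      over the rest, which \<open>split_difference_le\<close> bounds below.\<close>
    have "(int q - 1) * ((\<Sum>C\<in>?P. ?c (rep C)) - int q * (\<Sum>C\<in>?P - A. ?c (rep C)))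
      = (int q - 1) * (int q ^ (k - 1) * (int a - int b))"
      using bal unfolding sU sH by (simp add: algebra_simps)
    then have "(\<Sum>C\<in>?P. ?c (rep C)) - int q * (\<Sum>C\<in>?P - A. ?c (rep C))
      = int q ^ (k - 1) * (int a - int b)"
      using q2 by simp
    moreover have "(\<Sum>C\<in>?P. ?c (rep C)) = (\<Sum>C\<in>A. ?c (rep C)) + (\<Sum>C\<in>?P - A. ?c (rep C))"
      using sum.subset_diff[OF AP fP, of "\<lambda>C. ?c (rep C)"] by simp
    moreover have "split_difference q k S
      \<le> (\<Sum>C\<in>A. ?c (rep C)) - (int q - 1) * (\<Sum>C\<in>?P - A. ?c (rep C))"
      unfolding S_eq using fP AP cA cP q2 by (intro split_difference_le) auto
    ultimately have "- (int q ^ (k - 1)) < int q ^ (k - 1) * (int a - int b)"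
      using assms(4) by (simp add: left_diff_distrib)
    \<comment> \<open>The strict bound divided by \<open>q ^ (k - 1)\<close> gives
      \<open>a - b > -1\<close>, and integrality turns this into \<open>b \<le> a\<close>.\<close>
    then have "int q ^ (k - 1) * (-1) < int q ^ (k - 1) * (int a - int b)" by simp
    then have "-1 < int a - int b"
      using q2 by (subst (asm) mult_less_cancel_left_pos) auto
    then have "b \<le> a" by linarith
    then show "card {i \<in> {..<m}. kernel_on U (\<lambda>u. \<phi> u $ i) = kernel_on U (\<lambda>u. \<phi> u $ j)}
      \<le> card {i \<in> {..<n}. kernel_on U (\<lambda>u. u $ i) = kernel_on U (\<lambda>u. \<phi> u $ j)}"
      by (simp add: a_def b_def H_def \<nu>_def)
  qed
qed

end
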